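(* Let $d \geq 1$. Up to unimodular equivalence, all but finitely many hollow lattice $d$-polytopes $P \subset \mathbb{R}^d$ admit a lattice projection onto a hollow lattice $(d-1)$-polytope. That is, there is a finite set $\mathcal{F}_d$ of hollow lattice $d$-polytopes such that every hollow lattice $d$-polytope that is not unimodularly equivalent to a member of $\mathcal{F}_d$ admits a lattice projection onto a hollow lattice $(d-1)$-polytope.
   Context: A lattice polytope in $\mathbb{R}^d$ is the convex hull of finitely many points of $\mathbb{Z}^d$; a $d$-polytope is a full-dimensional one. Two lattice polytopes are unimodularly equivalent if there is an affine map $x \mapsto Ax+b$ with $A \in GL_d(\mathbb{Z})$, $b \in \mathbb{Z}^d$ mapping one onto the other. A convex body (compact convex set) is hollow if its interior contains no lattice point; a $0$-dimensional lattice polytope is considered hollow. A lattice projection of $\mathbb{R}^d$ is a surjective affine-linear map $\phi$ from $\mathbb{R}^d$ onto an $m$-dimensional real vector space $V$ whose kernel is affinely generated by lattice points (equivalently, $\phi(\mathbb{Z}^d)$ is a lattice of rank $m$); identifying $\phi(\mathbb{Z}^d)$ with $\mathbb{Z}^m$, the image $\phi(P)$ of a lattice polytope is a lattice polytope in $\mathbb{R}^m$, and hollowness of $\phi(P)$ is taken with respect to this lattice. *)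

theory Defs
  imports "HOL-Analysis.Analysis"
begin

definition int_lattice :: "(real ^ 'd) set" where
  "int_lattice = {x. \<forall>i. x $ i \<in> \<int>}"

definition lattice_polytope :: "'a::real_vector set \<Rightarrow> 'a set \<Rightarrow> bool" where
  "lattice_polytope \<Lambda> P \<longleftrightarrow> (\<exists>S. finite S \<and> S \<subseteq> \<Lambda> \<and> P = convex hull S)"

text \<open>
  Hollowness is relative to an ambient vector space \<open>V\<close>, given as a linear subspace of a
  Euclidean space, and a lattice \<open>\<Lambda>\<close> in \<open>V\<close>; the interior is the one in \<open>V\<close>. The first
  disjunct is the convention that points are hollow. It matters only if \<open>V\<close> is itself
  0-dimensional, because otherwise the interior of a point is empty.
\<close>

definition hollow :: "'a::euclidean_space set \<Rightarrow> 'a set \<Rightarrow> 'a set \<Rightarrow> bool" where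
  "hollow V \<Lambda> P \<longleftrightarrow> aff_dim P = 0 \<or> (top_of_set V interior_of P) \<inter> \<Lambda> = {}"

lemma hollow_UNIV: "hollow UNIV \<Lambda> P \<longleftrightarrow> interior P \<inter> \<Lambda> = {}"
  for P :: "'a::euclidean_space set"
proof -
  have "top_of_set UNIV interior_of P = interior P"
    by (auto simp: interior_of_def interior_def)
  moreover have "interior P = {}" if "aff_dim P = 0"
    using that aff_dim_nonempty_interior[of P] DIM_positive[where 'a='a] by force
  ultimately show ?thesis
    by (auto simp: hollow_def)
qed

definition hollow_full_lattice_polytope ::
    "'a::euclidean_space set \<Rightarrow> 'a set \<Rightarrow> 'a set \<Rightarrow> bool" where
  "hollow_full_lattice_polytope V \<Lambda> P \<longleftrightarrow>
     P \<subseteq> V \<and> lattice_polytope \<Lambda> P \<and> aff_dim P = int (dim V) \<and> hollow V \<Lambda> P"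

abbreviation hollow_lattice_d_polytope :: "(real ^ 'd) set \<Rightarrow> bool" where
  "hollow_lattice_d_polytope P \<equiv> hollow_full_lattice_polytope UNIV int_lattice P"

definition GL_int :: "(real ^ 'd ^ 'd) set" where
  "GL_int = {A. (\<forall>i j. A $ i $ j \<in> \<int>) \<and>
     (\<exists>B. (\<forall>i j. B $ i $ j \<in> \<int>) \<and> A ** B = mat 1 \<and> B ** A = mat 1)}"

definition unimodularly_equivalent :: "(real ^ 'd) set \<Rightarrow> (real ^ 'd) set \<Rightarrow> bool" where
  "unimodularly_equivalent P Q \<longleftrightarrow>
     (\<exists>A\<in>GL_int. \<exists>b\<in>int_lattice. (\<lambda>x. A *v x + b) ` P = Q)"

text \<open>
  The kernel of the affine map \<open>\<phi>\<close> is the fibre over the origin of \<open>V\<close>. Since it is the affine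
  hull of its lattice points and nonempty, \<open>\<phi>\<close> maps some lattice point to \<open>0\<close>, so the image of
  the integer lattice is a genuine lattice in \<open>V\<close> rather than a translate of one.
\<close>

definition lattice_projection ::
    "(real ^ 'd \<Rightarrow> 'b::euclidean_space) \<Rightarrow> 'b set \<Rightarrow> bool" where
  "lattice_projection \<phi> V \<longleftrightarrow>
     subspace V \<and>
     (\<exists>L c. linear L \<and> \<phi> = (\<lambda>x. L x + c)) \<and>
     range \<phi> = V \<and>
     affine hull ({x. \<phi> x = 0} \<inter> int_lattice) = {x. \<phi> x = 0}"

text \<open>
  The target is a linear subspace \<open>V\<close> of dimension \<open>d - 1\<close> of \<open>real ^ 'd\<close>, and not a type
  \<open>real ^ 'm\<close>, so that \<open>d = 1\<close> with a 0-dimensional target is covered. Every vector space of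
  dimension \<open>d - 1\<close> is isomorphic to such a \<open>V\<close>. Instead of being identified with the standard
  lattice of rank \<open>d - 1\<close>, the lattice in \<open>V\<close> is kept as the image of the integer lattice.
\<close>

definition projects_onto_hollow :: "(real ^ 'd) set \<Rightarrow> bool" where
  "projects_onto_hollow P \<longleftrightarrow>
     (\<exists>(\<phi> :: real ^ 'd \<Rightarrow> real ^ 'd) V.
        lattice_projection \<phi> V \<and> dim V = CARD('d) - 1 \<and>
        hollow_full_lattice_polytope V (\<phi> ` int_lattice) (\<phi> ` P))"

end

theory Submission
  imports Defs
begin

text \<open>
  Move a vertex of \<open>P\<close> to the origin and apply the linear map that sends a lattice simplex of maximal
  volume in \<open>P\<close> to the standard simplex. Then \<open>P\<close> lies between the standard simplex and the cube
  \<open>[-1,1]^d\<close>, and the integer lattice becomes a lattice \<open>\<Lambda>\<close> that contains it. Let \<open>D\<^sub>n\<close> be the set of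
  vectors of norm at most \<open>n\<close> in the dual of \<open>\<Lambda>\<close>, and \<open>U\<^sub>n\<close> its orthogonal complement.

  Averaging a positive trigonometric kernel over \<open>\<Lambda>\<close> modulo the integer lattice shows that, for large
  \<open>n\<close> and uniformly in \<open>\<Lambda>\<close>, every point with integral inner products with \<open>D\<^sub>n\<close>, in particular every
  point of \<open>U\<^sub>n\<close>, is close to \<open>\<Lambda>\<close>. On the other hand, for fixed \<open>n\<close> there are only finitely many
  possibilities for the image of \<open>P\<close> modulo \<open>U\<^sub>n\<close> and for a lattice point in its interior, so the
  fibre of \<open>P\<close> over such a point contains a point that is the centre of a ball inside \<open>P\<close> whose radius
  depends only on \<open>n\<close>. Hence, if \<open>n'\<close> is large in terms of \<open>n\<close> and \<open>U\<^sub>n\<^sub>' = U\<^sub>n\<close> is nonzero, then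
  hollowness of \<open>P\<close> forces the image of \<open>P\<close> modulo \<open>U\<^sub>n\<close> to be hollow, and so is the image modulo any
  line in \<open>U\<^sub>n\<close>. Along a rapidly increasing sequence of \<open>d + 1\<close> values of \<open>n\<close> the dimension of \<open>U\<^sub>n\<close>
  must stabilize or reach zero. If it reaches zero, there are only finitely many possibilities for
  \<open>\<Lambda>\<close> and \<open>P\<close>, which together determine the unimodular equivalence class.
\<close>

section \<open>Density of lattices in annihilators\<close>

text \<open>The half-open unit cube represents \<open>\<Lambda>\<close> modulo
  \<open>int_lattice\<close>, so the last condition says that \<open>int_lattice\<close> has finite
  index in \<open>\<Lambda>\<close>.\<close>

definition superlattice :: "(real ^ 'd) set \<Rightarrow> bool" where
  "superlattice \<Lambda> \<longleftrightarrow>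
     int_lattice \<subseteq> \<Lambda> \<and> (\<forall>x\<in>\<Lambda>. \<forall>y\<in>\<Lambda>. x - y \<in> \<Lambda>) \<and>
     finite (\<Lambda> \<inter> {x. \<forall>i. 0 \<le> x $ i \<and> x $ i < 1})"

text \<open>For a lattice this is the dual lattice. For finite \<open>D\<close> it is a closed group
  with identity component \<open>perp D\<close>.\<close>

definition annih :: "(real ^ 'd) set \<Rightarrow> (real ^ 'd) set" where
  "annih D = {x. \<forall>m\<in>D. m \<bullet> x \<in> \<int>}"

definition perp :: "(real ^ 'd) set \<Rightarrow> (real ^ 'd) set" where
  "perp D = {x. \<forall>m\<in>D. m \<bullet> x = 0}"

definition int_box :: "nat \<Rightarrow> (real ^ 'd) set" where
  "int_box n = {m \<in> int_lattice. \<forall>i. \<bar>m $ i\<bar> \<le> real n}"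

text \<open>Dual vectors of a lattice containing \<open>int_lattice\<close> are integral, so these
  are all the dual vectors of sup-norm at most \<open>n\<close>.\<close>

definition dual_box :: "nat \<Rightarrow> (real ^ 'd) set \<Rightarrow> (real ^ 'd) set" where
  "dual_box n \<Lambda> = int_box n \<inter> annih \<Lambda>"

lemma superlatticeD:
  assumes "superlattice \<Lambda>"
  shows "x \<in> int_lattice \<Longrightarrow> x \<in> \<Lambda>" "0 \<in> \<Lambda>"
    "x \<in> \<Lambda> \<Longrightarrow> y \<in> \<Lambda> \<Longrightarrow> x - y \<in> \<Lambda>"
    "x \<in> \<Lambda> \<Longrightarrow> y \<in> \<Lambda> \<Longrightarrow> x + y \<in> \<Lambda>"
proof -
  show 1: "x \<in> int_lattice \<Longrightarrow> x \<in> \<Lambda>" "x \<in> \<Lambda> \<Longrightarrow> y \<in> \<Lambda> \<Longrightarrow> x - y \<in> \<Lambda>" for x y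
    using assms by (auto simp: superlattice_def)
  show 0: "0 \<in> \<Lambda>"
    by (rule 1) (simp add: int_lattice_def)
  show "x + y \<in> \<Lambda>" if "x \<in> \<Lambda>" "y \<in> \<Lambda>"
    using 1(2)[OF that(1) 1(2)[OF 0 that(2)]] by simp
qed

lemma inner_int_lattice:
  fixes x y :: "real ^ 'd"
  assumes "x \<in> int_lattice" "y \<in> int_lattice"
  shows "x \<bullet> y \<in> \<int>"
  using assms by (auto simp: int_lattice_def inner_vec_def intro!: Ints_sum Ints_mult)

section \<open>Averages of a trigonometric kernel over a lattice\<close>

definition frac_vec :: "real ^ 'd \<Rightarrow> real ^ 'd" where
  "frac_vec x = (\<chi> i. frac (x $ i))"

lemma frac_vec_diff: "x - frac_vec x \<in> int_lattice"
  by (auto simp: frac_vec_def int_lattice_def frac_def)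

lemma cis_2pi_int: "k \<in> \<int> \<Longrightarrow> cis (2 * pi * k) = 1"
  by (auto simp: cis_multiple_2pi)

lemma cis_2pi_eq_1_iff: "cis (2 * pi * k) = 1 \<longleftrightarrow> k \<in> \<int>"
proof
  assume "cis (2 * pi * k) = 1"
  then have "cos (2 * pi * k) = 1"
    by (metis cis.simps(1) one_complex.simps(1))
  then show "k \<in> \<int>"
    by (auto simp: cos_one_2pi_int mult.commute)
qed (rule cis_2pi_int)

text \<open>Orthogonality of characters on the finite group \<open>\<Lambda>\<close> modulo
  \<open>int_lattice\<close>: a shift by \<open>l\<close> with \<open>m \<bullet> l\<close> not
  integral permutes the representatives \<open>H\<close> and multiplies the sum by a factor other
  than 1.\<close>

lemma character_sum:
  fixes \<Lambda> :: "(real ^ 'd) set"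
  assumes \<Lambda>: "superlattice \<Lambda>" and m: "m \<in> int_lattice"
  defines "H \<equiv> \<Lambda> \<inter> {x. \<forall>i. 0 \<le> x $ i \<and> x $ i < 1}"
  shows "(\<Sum>h\<in>H. cis (2 * pi * (m \<bullet> h))) = (if m \<in> annih \<Lambda> then of_nat (card H) else 0)"
proof (cases "m \<in> annih \<Lambda>")
  case True
  then show ?thesis
    by (auto simp: H_def annih_def cis_2pi_int inner_commute)
next
  case False
  then obtain l where l: "l \<in> \<Lambda>" "m \<bullet> l \<notin> \<int>"
    by (auto simp: annih_def inner_commute)
  have finH: "finite H"
    using \<Lambda> by (simp add: superlattice_def H_def)
  have cis_frac: "cis (2 * pi * (m \<bullet> frac_vec x)) = cis (2 * pi * (m \<bullet> x))" for x
  proof -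
    have "cis (2 * pi * (m \<bullet> x)) = cis (2 * pi * (m \<bullet> (x - frac_vec x))) * cis (2 * pi * (m \<bullet> frac_vec x))"
      by (simp add: cis_mult inner_diff_right algebra_simps)
    then show ?thesis
      using cis_2pi_int[OF inner_int_lattice[OF m frac_vec_diff]] by simp
  qed
  have frac_H: "frac_vec x \<in> H" if "x \<in> \<Lambda>" for x
    using superlatticeD(3)[OF \<Lambda> that superlatticeD(1)[OF \<Lambda> frac_vec_diff[of x]]]
    by (auto simp: H_def frac_vec_def frac_lt_1)
  have inj: "inj_on (\<lambda>h. frac_vec (h + l)) H"
  proof (rule inj_onI)
    fix x y assume xy: "x \<in> H" "y \<in> H" "frac_vec (x + l) = frac_vec (y + l)"
    have "x - y \<in> int_lattice"
    proof -
      have "(x + l - frac_vec (x + l)) - (y + l - frac_vec (y + l)) \<in> int_lattice"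
        using frac_vec_diff[of "x + l"] frac_vec_diff[of "y + l"] unfolding int_lattice_def mem_Collect_eq
        by (metis Ints_diff vector_minus_component)
      then show ?thesis
        using xy by simp
    qed
    moreover have "\<bar>(x - y) $ i\<bar> < 1" for i
    proof -
      have "0 \<le> x $ i" "x $ i < 1" "0 \<le> y $ i" "y $ i < 1"
        using xy by (auto simp: H_def)
      then show ?thesis by auto
    qed
    ultimately have "(x - y) $ i = 0" for i
      using Ints_nonzero_abs_less1[of "(x - y) $ i"] by (auto simp: int_lattice_def)
    then show "x = y"
      by (simp add: vec_eq_iff)
  qed
  have img: "(\<lambda>h. frac_vec (h + l)) ` H = H"
    using inj finH frac_H superlatticeD(4)[OF \<Lambda> _ l(1)]
    by (intro endo_inj_surj) (auto simp: H_def)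
  let ?s = "\<Sum>h\<in>H. cis (2 * pi * (m \<bullet> h))"
  have "?s = (\<Sum>h\<in>H. cis (2 * pi * (m \<bullet> frac_vec (h + l))))"
    using sum.reindex[OF inj, of "\<lambda>h. cis (2 * pi * (m \<bullet> h))"] img by (simp add: o_def)
  also have "\<dots> = (\<Sum>h\<in>H. cis (2 * pi * (m \<bullet> l)) * cis (2 * pi * (m \<bullet> h)))"
    unfolding cis_frac cis_mult by (rule sum.cong) (simp_all add: inner_add_right algebra_simps)
  also have "\<dots> = cis (2 * pi * (m \<bullet> l)) * ?s"
    by (simp add: sum_distrib_left)
  finally have "?s = 0"
    using l(2) cis_2pi_eq_1_iff[of "m \<bullet> l"] by simp
  then show ?thesis
    using False by simp
qed

text \<open>Binomial theorem for \<open>cos t = (cis t + cis (- t)) / 2\<close>. The even exponent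
  makes the frequencies integral; they range from \<open>- n\<close> to \<open>n\<close>.\<close>

lemma cos_power_expansion:
  "complex_of_real (cos (pi * x) ^ (2 * n)) =
     (\<Sum>k\<le>2*n. of_real (real (2 * n choose k) / 4 ^ n) * cis (2 * pi * ((real k - real n) * x)))"
proof -
  have "complex_of_real (cos (pi * x)) = (cis (pi * x) + cis (- (pi * x))) / 2"
    by (simp add: complex_eq_iff)
  then have "complex_of_real (cos (pi * x) ^ (2 * n)) = (cis (pi * x) + cis (- (pi * x))) ^ (2 * n) / 2 ^ (2 * n)"
    by (simp only: of_real_power power_divide)
  also have "\<dots> = (\<Sum>k\<le>2*n. of_nat (2 * n choose k) * cis (pi * x) ^ k * cis (- (pi * x)) ^ (2 * n - k)) / 4 ^ n"
    unfolding binomial_ring by (simp add: power_mult)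
  also have "\<dots> = (\<Sum>k\<le>2*n. of_real (real (2 * n choose k) / 4 ^ n) * cis (2 * pi * ((real k - real n) * x)))"
    unfolding sum_divide_distrib
  proof (rule sum.cong)
    fix k assume "k \<in> {..2 * n}"
    then have "real k * (pi * x) + real (2 * n - k) * (- (pi * x)) = 2 * pi * ((real k - real n) * x)"
      by (simp add: of_nat_diff algebra_simps)
    then have "cis (pi * x) ^ k * cis (- (pi * x)) ^ (2 * n - k) = cis (2 * pi * ((real k - real n) * x))"
      by (simp only: Complex.DeMoivre cis_mult)
    then show "of_nat (2 * n choose k) * cis (pi * x) ^ k * cis (- (pi * x)) ^ (2 * n - k) / 4 ^ n =
      of_real (real (2 * n choose k) / 4 ^ n) * cis (2 * pi * ((real k - real n) * x))"
      by (simp add: mult.assoc)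
  qed simp
  finally show ?thesis .
qed

text \<open>The kernel has nonnegative Fourier coefficients, supported on \<open>int_box n\<close>.
  Averaging over \<open>H\<close> leaves only frequencies in \<open>dual_box n \<Lambda>\<close>;
  there \<open>m \<bullet> g\<close> is integral, so each contributes its coefficient. The zero
  frequency alone gives the bound.\<close>

lemma kernel_mean:
  fixes \<Lambda> :: "(real ^ 'd) set"
  assumes \<Lambda>: "superlattice \<Lambda>" and g: "g \<in> annih (dual_box n \<Lambda>)"
  defines "H \<equiv> \<Lambda> \<inter> {x. \<forall>i. 0 \<le> x $ i \<and> x $ i < 1}"
  shows "real (card H) * (real (2 * n choose n) / 4 ^ n) ^ CARD('d) \<le>
    (\<Sum>h\<in>H. \<Prod>i\<in>UNIV. cos (pi * (g - h) $ i) ^ (2 * n))"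
proof -
  define K where "K = PiE (UNIV :: 'd set) (\<lambda>_. {..2 * n})"
  define c where "c k = (\<Prod>i\<in>UNIV. real (2 * n choose k i) / 4 ^ n)" for k :: "'d \<Rightarrow> nat"
  define m :: "('d \<Rightarrow> nat) \<Rightarrow> real ^ 'd" where "m k = (\<chi> i. real (k i) - real n)" for k
  have finK: "finite K"
    by (simp add: K_def finite_PiE)
  have m_int: "m k \<in> int_lattice" for k
    by (auto simp: m_def int_lattice_def)
  have m_box: "m k \<in> int_box n" if "k \<in> K" for k
  proof -
    have "k i \<le> 2 * n" for i
      using that by (auto simp: K_def)
    then have "real (k i) \<le> real (2 * n)" for i
      by (simp only: of_nat_le_iff)
    then have "\<bar>real (k i) - real n\<bar> \<le> real n" for i
      by (simp add: abs_le_iff)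
    then show ?thesis
      using m_int[of k] by (auto simp: int_box_def m_def)
  qed
  have prod_cis: "(\<Prod>i\<in>UNIV. cis (2 * pi * ((real (k i) - real n) * x $ i))) = cis (2 * pi * (m k \<bullet> x))"
    for k and x :: "real ^ 'd"
    by (simp add: m_def inner_vec_def sum_distrib_left cis_conv_exp exp_sum[symmetric])
  have prod_exp: "complex_of_real (\<Prod>i\<in>UNIV. cos (pi * x $ i) ^ (2 * n)) =
      (\<Sum>k\<in>K. of_real (c k) * cis (2 * pi * (m k \<bullet> x)))" for x :: "real ^ 'd"
  proof -
    have "complex_of_real (\<Prod>i\<in>UNIV. cos (pi * x $ i) ^ (2 * n)) =
      (\<Prod>i\<in>UNIV. \<Sum>k\<le>2*n. of_real (real (2 * n choose k) / 4 ^ n) * cis (2 * pi * ((real k - real n) * x $ i)))"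
      unfolding of_real_prod cos_power_expansion ..
    also have "\<dots> = (\<Sum>k\<in>K. \<Prod>i\<in>UNIV. of_real (real (2 * n choose k i) / 4 ^ n) * cis (2 * pi * ((real (k i) - real n) * x $ i)))"
      unfolding K_def by (rule prod_sum_PiE) auto
    also have "\<dots> = (\<Sum>k\<in>K. of_real (c k) * cis (2 * pi * (m k \<bullet> x)))"
      by (simp only: prod.distrib prod_cis c_def of_real_prod)
    finally show ?thesis .
  qed
  have inner_sum: "(\<Sum>h\<in>H. cis (2 * pi * (m k \<bullet> (g - h)))) = of_real (if m k \<in> annih \<Lambda> then real (card H) else 0)"
    if k: "k \<in> K" for k
  proof -
    have "cis (2 * pi * (m k \<bullet> (g - h))) = cis (2 * pi * (m k \<bullet> g)) * cis (2 * pi * ((- m k) \<bullet> h))" for h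
      by (simp add: cis_mult inner_diff_right algebra_simps)
    then have "(\<Sum>h\<in>H. cis (2 * pi * (m k \<bullet> (g - h)))) = cis (2 * pi * (m k \<bullet> g)) * (\<Sum>h\<in>H. cis (2 * pi * ((- m k) \<bullet> h)))"
      by (simp only: sum_distrib_left)
    also have "(\<Sum>h\<in>H. cis (2 * pi * ((- m k) \<bullet> h))) = (if - m k \<in> annih \<Lambda> then of_nat (card H) else 0)"
      unfolding H_def by (rule character_sum[OF \<Lambda>]) (use m_int[of k] in \<open>auto simp: int_lattice_def\<close>)
    also have "- m k \<in> annih \<Lambda> \<longleftrightarrow> m k \<in> annih \<Lambda>"
      by (simp add: annih_def minus_in_Ints_iff)
    finally have *: "(\<Sum>h\<in>H. cis (2 * pi * (m k \<bullet> (g - h)))) =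
        cis (2 * pi * (m k \<bullet> g)) * (if m k \<in> annih \<Lambda> then of_nat (card H) else 0)" .
    show ?thesis
    proof (cases "m k \<in> annih \<Lambda>")
      case True
      then have "m k \<bullet> g \<in> \<int>"
        using g m_box[OF k] by (auto simp: annih_def dual_box_def)
      then show ?thesis
        using * True by (simp add: cis_2pi_int)
    qed (use * in simp)
  qed
  have "complex_of_real (\<Sum>h\<in>H. \<Prod>i\<in>UNIV. cos (pi * (g - h) $ i) ^ (2 * n)) =
      (\<Sum>h\<in>H. \<Sum>k\<in>K. of_real (c k) * cis (2 * pi * (m k \<bullet> (g - h))))"
    unfolding of_real_sum prod_exp ..
  also have "\<dots> = (\<Sum>k\<in>K. of_real (c k) * (\<Sum>h\<in>H. cis (2 * pi * (m k \<bullet> (g - h)))))"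
    by (subst sum.swap) (simp only: sum_distrib_left)
  also have "\<dots> = (\<Sum>k\<in>K. of_real (c k) * of_real (if m k \<in> annih \<Lambda> then real (card H) else 0))"
    by (rule sum.cong) (simp_all only: inner_sum)
  also have "\<dots> = of_real (\<Sum>k\<in>K. c k * (if m k \<in> annih \<Lambda> then real (card H) else 0))"
    by simp
  finally have eq: "(\<Sum>h\<in>H. \<Prod>i\<in>UNIV. cos (pi * (g - h) $ i) ^ (2 * n)) =
      (\<Sum>k\<in>K. c k * (if m k \<in> annih \<Lambda> then real (card H) else 0))"
    by (simp only: of_real_eq_iff)
  \<comment> \<open>As \<open>m k\<close> is \<open>k\<close> shifted by \<open>n\<close>, the
    constant \<open>n\<close> is the zero frequency.\<close>
  have "c (\<lambda>_. n) * (if m (\<lambda>_. n) \<in> annih \<Lambda> then real (card H) else 0) \<le>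
      (\<Sum>k\<in>K. c k * (if m k \<in> annih \<Lambda> then real (card H) else 0))"
    by (rule member_le_sum)
      (auto simp: K_def finK[unfolded K_def] c_def intro!: prod_nonneg mult_nonneg_nonneg)
  moreover have "m (\<lambda>_. n) \<in> annih \<Lambda>"
    by (simp add: m_def annih_def inner_vec_def)
  ultimately show ?thesis
    unfolding eq by (simp add: c_def mult.commute)
qed

text \<open>\<open>\<bar>cos (pi * x)\<bar>\<close> has period 1 and decreases with the distance of
  \<open>x\<close> to the nearest integer.\<close>

lemma cos_pi_bound:
  fixes x r :: real
  assumes "\<And>k. k \<in> \<int> \<Longrightarrow> r \<le> \<bar>x - k\<bar>" "0 < r" "r \<le> 1 / 2"
  shows "\<bar>cos (pi * x)\<bar> \<le> cos (pi * r)"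
proof -
  define y where "y = x - of_int (round x)"
  have y: "r \<le> \<bar>y\<bar>" "\<bar>y\<bar> \<le> 1 / 2"
    using assms(1)[of "of_int (round x)"] of_int_round_abs_le[of x]
    by (auto simp: y_def abs_minus_commute)
  have "pi * x = pi * y + of_int (round x) * pi"
    by (simp add: y_def algebra_simps)
  moreover have "sin (of_int (round x) * pi) = 0" "\<bar>cos (of_int (round x) * pi)\<bar> = 1"
    using sin_zero_abs_cos_one[of "of_int (round x) * pi"] by (auto simp: sin_times_pi_eq_0)
  ultimately have "\<bar>cos (pi * x)\<bar> = \<bar>cos (pi * y)\<bar>"
    by (simp add: cos_add abs_mult)
  also have "\<dots> = \<bar>cos (pi * \<bar>y\<bar>)\<bar>"
    by (cases "y \<ge> 0") auto
  also have "\<dots> = cos (pi * \<bar>y\<bar>)"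
    using y pi_gt_zero by (intro abs_of_nonneg cos_ge_zero) (auto intro: order_trans[of _ 0] simp: mult_left_le)
  also have "\<dots> \<le> cos (pi * r)"
    using y assms by (intro cos_monotone_0_pi_le) (auto intro: mult_left_le)
  finally show ?thesis .
qed

lemma exp_beats_power:
  fixes \<rho> :: real
  assumes "0 \<le> \<rho>" "\<rho> < 1" "d > 0"
  shows "\<forall>\<^sub>F n in sequentially. \<rho> ^ (2 * n) < (1 / (2 * real n)) ^ d"
proof -
  have "(\<lambda>n. real n ^ d * \<rho> ^ n) \<longlonglongrightarrow> 0"
  proof -
    \<comment> \<open>The root turns \<open>n ^ d * \<rho> ^ n\<close> into a power of
      \<open>n * \<sigma> ^ n\<close>, which tends to 0.\<close>
    define \<sigma> where "\<sigma> = root d \<rho>"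
    have \<sigma>: "0 \<le> \<sigma>" "\<sigma> < 1" "\<sigma> ^ d = \<rho>"
      using assms by (auto simp: \<sigma>_def)
    have "(\<lambda>n. (real n * \<sigma> ^ n) ^ d) \<longlonglongrightarrow> 0 ^ d"
      using \<sigma> by (intro tendsto_power powser_times_n_limit_0) auto
    moreover have "(real n * \<sigma> ^ n) ^ d = real n ^ d * \<rho> ^ n" for n
      by (simp add: power_mult_distrib \<sigma>(3)[symmetric] flip: power_mult) (simp add: mult.commute)
    ultimately show ?thesis
      using \<open>d > 0\<close> by (simp add: power_0_left)
  qed
  then have "(\<lambda>n. real (2 * n) ^ d * \<rho> ^ (2 * n)) \<longlonglongrightarrow> 0"
    by (rule LIMSEQ_subseq_LIMSEQ[of _ _ "\<lambda>n. 2 * n", unfolded o_def]) (simp add: strict_mono_def)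
  then have "\<forall>\<^sub>F n in sequentially. real (2 * n) ^ d * \<rho> ^ (2 * n) < 1"
    by (rule order_tendstoD) simp
  then show ?thesis
    using eventually_gt_at_top[of 0]
    by eventually_elim (simp add: power_divide field_simps)
qed

text \<open>The mean of the kernel is at least an inverse power of \<open>n\<close>, so some
  \<open>h\<close> has at least this value. A coordinate of \<open>g - h\<close> at distance
  \<open>s\<close> or more from the integers would force an exponentially small value. The threshold
  for \<open>n\<close> does not involve \<open>\<Lambda>\<close>.\<close>

lemma dense_in_annih:
  fixes r :: real
  assumes "0 < r"
  shows "\<forall>\<^sub>F n in sequentially. \<forall>\<Lambda> g. superlattice \<Lambda> \<longrightarrow> g \<in> annih (dual_box n \<Lambda>) \<longrightarrow>
    (\<exists>x\<in>\<Lambda>. \<forall>i::'d::finite. \<bar>g $ i - x $ i\<bar> < r)"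
proof -
  \<comment> \<open>The cap at 1/2 keeps \<open>cos (pi * s)\<close> nonnegative.\<close>
  define s where "s = min r (1 / 2)"
  have s: "0 < s" "s \<le> 1 / 2" "s \<le> r"
    using assms by (auto simp: s_def)
  define \<rho> where "\<rho> = cos (pi * s)"
  have "0 \<le> \<rho>"
    unfolding \<rho>_def using s pi_gt_zero by (intro cos_ge_zero) (auto intro: order_trans[of _ 0] simp: mult_left_le)
  have "\<rho> < cos 0"
    unfolding \<rho>_def using s by (intro cos_monotone_0_pi) auto
  then have "\<rho> < 1"
    by simp
  from exp_beats_power[OF \<open>0 \<le> \<rho>\<close> this, of "CARD('d)", OF zero_less_card_finite] eventually_gt_at_top[of "0::nat"]
  show ?thesis
  proof eventually_elim
    case (elim n)
    show ?case
    proof (intro allI impI)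
      fix \<Lambda> :: "(real ^ 'd) set" and g
      assume \<Lambda>: "superlattice \<Lambda>" and g: "g \<in> annih (dual_box n \<Lambda>)"
      define H where "H = \<Lambda> \<inter> {x. \<forall>i. 0 \<le> x $ i \<and> x $ i < 1}"
      have H: "finite H" "0 \<in> H"
        using \<Lambda> superlatticeD(2)[OF \<Lambda>] by (auto simp: H_def superlattice_def)
      define C where "C = (real (2 * n choose n) / 4 ^ n) ^ CARD('d)"
      have C: "(1 / (2 * real n)) ^ CARD('d) \<le> C"
        unfolding C_def using central_binomial_lower_bound[of n] elim
        by (intro power_mono) (auto simp: field_simps)
      obtain h where h: "h \<in> H" "C \<le> (\<Prod>i\<in>UNIV. cos (pi * (g - h) $ i) ^ (2 * n))"
      proof (rule ccontr)
        assume "\<not> thesis"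
        then have "(\<Sum>h\<in>H. \<Prod>i\<in>UNIV. cos (pi * (g - h) $ i) ^ (2 * n)) < (\<Sum>h\<in>H. C)"
          using that H by (intro sum_strict_mono) force+
        then show False
          using kernel_mean[OF \<Lambda> g] by (simp add: H_def C_def)
      qed
      have "\<exists>k\<in>\<int>. \<bar>(g - h) $ i - k\<bar> < s" for i
      proof (rule ccontr)
        assume "\<not> (\<exists>k\<in>\<int>. \<bar>(g - h) $ i - k\<bar> < s)"
        then have "\<bar>cos (pi * (g - h) $ i)\<bar> \<le> \<rho>"
          unfolding \<rho>_def using s by (intro cos_pi_bound) force+
        then have "\<bar>cos (pi * (g - h) $ i)\<bar> ^ (2 * n) \<le> \<rho> ^ (2 * n)"
          by (intro power_mono) auto
        then have i: "cos (pi * (g - h) $ i) ^ (2 * n) \<le> \<rho> ^ (2 * n)"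
          by (simp add: power_even_abs)
        have "(\<Prod>j\<in>UNIV. cos (pi * (g - h) $ j) ^ (2 * n)) =
            cos (pi * (g - h) $ i) ^ (2 * n) * (\<Prod>j\<in>UNIV-{i}. cos (pi * (g - h) $ j) ^ (2 * n))"
          by (rule prod.remove) auto
        also have "\<dots> \<le> \<rho> ^ (2 * n) * 1"
          using i by (intro mult_mono prod_le_1 prod_nonneg)
            (auto simp: power_mult power_le_one abs_square_le_1)
        finally show False
          using h C elim by simp
      qed
      then obtain k where k: "\<And>i. k i \<in> \<int>" "\<And>i. \<bar>(g - h) $ i - k i\<bar> < s"
        by metis
      show "\<exists>x\<in>\<Lambda>. \<forall>i. \<bar>g $ i - x $ i\<bar> < r"
      proof (rule bexI[of _ "h + (\<chi> i. k i)"])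
        show "\<forall>i. \<bar>g $ i - (h + (\<chi> i. k i)) $ i\<bar> < r"
          using k(2) s by (auto simp: algebra_simps intro: less_le_trans)
        show "h + (\<chi> i. k i) \<in> \<Lambda>"
          using h(1) k(1) superlatticeD(1)[OF \<Lambda>, of "\<chi> i. k i"]
          by (intro superlatticeD(4)[OF \<Lambda>]) (auto simp: H_def int_lattice_def)
      qed
    qed
  qed
qed

section \<open>Hollow directions\<close>

lemma mem_cube: "x \<in> cbox (- 1) (1 :: real ^ 'd) \<longleftrightarrow> (\<forall>i. \<bar>x $ i\<bar> \<le> 1)"
  by (simp add: mem_box_cart abs_le_iff minus_le_iff) blast

lemma abs_inner_le:
  fixes x y :: "real ^ 'd"
  assumes "\<And>i. \<bar>x $ i\<bar> \<le> a" "\<And>i. \<bar>y $ i\<bar> \<le> b" "0 \<le> a"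
  shows "\<bar>x \<bullet> y\<bar> \<le> real CARD('d) * (a * b)"
proof -
  have "\<bar>x \<bullet> y\<bar> \<le> (\<Sum>i\<in>UNIV. \<bar>x $ i * y $ i\<bar>)"
    unfolding inner_vec_def by (simp add: sum_abs)
  also have "\<dots> \<le> (\<Sum>i\<in>(UNIV :: 'd set). a * b)"
    using assms by (intro sum_mono) (auto simp: abs_mult intro!: mult_mono)
  finally show ?thesis
    by simp
qed

lemma finite_int_vec_bounded: "finite {x \<in> int_lattice. \<forall>i. \<bar>(x :: real ^ 'd) $ i\<bar> \<le> b}"
proof (rule finite_imageD[of vec_nth])
  have "finite (PiE (UNIV :: 'd set) (\<lambda>_. {k \<in> \<int>. \<bar>k\<bar> \<le> b}))" (is "finite ?A")
    by (intro finite_PiE) (auto simp: finite_abs_int_segment)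
  then show "finite (vec_nth ` {x \<in> int_lattice. \<forall>i. \<bar>(x :: real ^ 'd) $ i\<bar> \<le> b})"
    by (rule rev_finite_subset) (auto simp: int_lattice_def)
  show "inj_on vec_nth {x \<in> int_lattice. \<forall>i. \<bar>(x :: real ^ 'd) $ i\<bar> \<le> b}"
    by (simp add: inj_on_def vec_nth_inject)
qed

lemma finite_int_box: "finite (int_box n :: (real ^ 'd) set)"
  unfolding int_box_def by (rule finite_int_vec_bounded)

lemma int_box_mono:
  assumes "n \<le> n'"
  shows "int_box n \<subseteq> (int_box n' :: (real ^ 'd) set)"
  using assms unfolding int_box_def by (auto intro: order_trans[of _ "real n" "real n'"])

lemma subspace_perp: "subspace (perp D)"
  by (auto simp: subspace_def perp_def inner_add_right)

lemma perp_subset_annih: "perp D \<subseteq> annih D"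
  by (auto simp: perp_def annih_def)

lemma annih_diff: "x \<in> annih D \<Longrightarrow> y \<in> annih D \<Longrightarrow> x - y \<in> annih D"
  by (auto simp: annih_def inner_diff_right)

text \<open>A coset of \<open>perp D\<close> is determined by the values
  \<open>m \<bullet> x\<close> for \<open>m\<close> in \<open>D\<close>, and on the cube these are
  bounded integers.\<close>

lemma finite_cosets:
  fixes D :: "(real ^ 'd) set"
  assumes "finite D"
  shows "finite ((\<lambda>x. {z. z - x \<in> perp D}) ` (annih D \<inter> cbox (- 1) 1))"
proof -
  obtain b where b: "\<And>m i. m \<in> D \<Longrightarrow> \<bar>m $ i\<bar> \<le> b" and "0 \<le> b"
  proof -
    obtain b where "\<And>m. m \<in> D \<Longrightarrow> norm m \<le> b"
      using finite_imp_bounded[OF assms] by (auto simp: bounded_iff)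
    then show thesis
      by (intro that[of "max b 0"]) (auto intro: order_trans[OF component_le_norm_cart] simp: le_max_iff_disj)
  qed
  define f where "f x = restrict (\<lambda>m. m \<bullet> x) D" for x
  have "f ` (annih D \<inter> cbox (- 1) 1) \<subseteq> PiE D (\<lambda>_. {k \<in> \<int>. \<bar>k\<bar> \<le> real CARD('d) * (b * 1)})"
    using b \<open>0 \<le> b\<close> by (auto simp: f_def annih_def mem_cube simp del: mult_1_right intro!: abs_inner_le)
  then have "finite (f ` (annih D \<inter> cbox (- 1) 1))"
    by (rule finite_subset) (intro finite_PiE assms finite_abs_int_segment)
  then have "finite ((\<lambda>h. {z. \<forall>m\<in>D. m \<bullet> z = h m}) ` f ` (annih D \<inter> cbox (- 1) 1))"
    by (rule finite_imageI)
  also have "(\<lambda>h. {z. \<forall>m\<in>D. m \<bullet> z = h m}) ` f ` (annih D \<inter> cbox (- 1) 1) =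
      (\<lambda>x. {z. z - x \<in> perp D}) ` (annih D \<inter> cbox (- 1) 1)"
    by (simp add: image_image f_def perp_def inner_diff_right)
  finally show ?thesis .
qed

text \<open>Adding a subspace commutes with taking convex hulls, so \<open>convex hull S + U\<close>
  depends on \<open>S\<close> only modulo \<open>U\<close>.\<close>

lemma convex_hull_plus_subset:
  fixes U :: "'a::real_vector set"
  assumes "subspace U" "S \<subseteq> T + U"
  shows "convex hull S + U \<subseteq> convex hull T + U"
proof -
  have UU: "U + U \<subseteq> U"
    using assms(1) by (auto simp: set_plus_def subspace_add)
  have "convex hull S \<subseteq> convex hull (T + U)"
    by (rule hull_mono[OF assms(2)])
  also have "\<dots> = convex hull T + U"
    using assms(1) by (simp add: convex_hull_set_plus hull_same subspace_imp_convex)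
  finally have "convex hull S + U \<subseteq> convex hull T + U + U"
    by (rule set_plus_mono2) simp
  also have "\<dots> \<subseteq> convex hull T + U"
    using UU by (metis add.assoc order_refl set_plus_mono2)
  finally show ?thesis .
qed

section \<open>Interior points of uniform depth\<close>

definition corners :: "(real ^ 'd) set" where
  "corners = insert 0 (range (\<lambda>i. axis i 1))"

lemma interior_corners:
  obtains c :: "real ^ 'd" and r where "0 < r" "ball c r \<subseteq> convex hull corners"
proof -
  have "insert 0 Basis \<subseteq> (corners :: (real ^ 'd) set)"
    by (auto simp: corners_def Basis_vec_def)
  then have "convex hull (insert 0 Basis) \<subseteq> convex hull (corners :: (real ^ 'd) set)"
    by (rule hull_mono)
  moreover obtain c :: "real ^ 'd" where "c \<in> interior (convex hull (insert 0 Basis))"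
    by (rule interior_std_simplex_nonempty)
  then obtain r where "0 < r" "ball c r \<subseteq> convex hull (insert 0 Basis)"
    by (auto simp: mem_interior)
  ultimately show thesis
    using that[of r c] by (meson order_trans)
qed

lemma ex_uniform_pos:
  fixes P :: "'a \<Rightarrow> real \<Rightarrow> bool"
  assumes "finite X" "\<And>x. x \<in> X \<Longrightarrow> \<exists>R>0. P x R" "\<And>x R R'. P x R \<Longrightarrow> 0 < R' \<Longrightarrow> R' \<le> R \<Longrightarrow> P x R'"
  shows "\<exists>R>0. \<forall>x\<in>X. P x R"
  using assms(1,2)
proof (induction X)
  case (insert x X)
  obtain R where "0 < R" "P x R"
    using insert.prems by auto
  moreover obtain R' where "0 < R'" "\<forall>x\<in>X. P x R'"
    using insert by auto
  ultimately show ?case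
    by (intro exI[of _ "min R R'"]) (auto intro: assms(3))
qed (auto intro: exI[of _ 1])

text \<open>The cosets of \<open>perp D\<close> met by \<open>S\<close>, together with that of
  \<open>q\<close>, take finitely many values, so one positive radius per value suffices. For a
  fixed value, a point slightly beyond \<open>q0\<close>, seen from the centre \<open>c\<close> of a
  ball in the standard simplex, is congruent to some \<open>p\<close> in the hull; shrinking the
  ball towards \<open>p\<close> centres it over the coset of \<open>q\<close>.\<close>

lemma uniform_depth:
  fixes D :: "(real ^ 'd) set"
  assumes "finite D"
  shows "\<exists>R>0. \<forall>S q. corners \<subseteq> S \<longrightarrow> S \<subseteq> annih D \<inter> cbox (- 1) 1 \<longrightarrow> q \<in> annih D \<longrightarrow>
    q \<in> interior (convex hull S + perp D) \<longrightarrow> (\<exists>y. y - q \<in> perp D \<and> ball y R \<subseteq> convex hull S)"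
proof -
  define U where "U = perp D"
  have U: "subspace U"
    by (simp add: U_def subspace_perp)
  define coset where "coset x = {z. z - x \<in> U}" for x
  have cosetI: "x \<in> coset x" for x
    using U by (simp add: coset_def subspace_0)
  define X where "X = Pow (coset ` (annih D \<inter> cbox (- 1) 1)) \<times> coset ` (annih D \<inter> cbox (- 1) 1)"
  have finX: "finite X"
    using finite_cosets[OF assms] by (simp add: X_def coset_def U_def)
  define good where "good S q \<longleftrightarrow> corners \<subseteq> S \<and> S \<subseteq> annih D \<inter> cbox (- 1) 1 \<and> q \<in> annih D \<and>
      q \<in> interior (convex hull S + U)" for S q
  define Q where "Q = (\<lambda>(\<S>, \<kappa>) R. \<forall>S q. good S q \<longrightarrow> coset ` S = \<S> \<longrightarrow> coset q = \<kappa> \<longrightarrow>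
      (\<exists>y. y - q \<in> U \<and> ball y R \<subseteq> convex hull S))"
  have "\<exists>R>0. Q x R" if "x \<in> X" for x
  proof (cases "\<exists>S q. good S q \<and> x = (coset ` S, coset q)")
    case False
    then show ?thesis
      by (auto simp: Q_def intro!: exI[of _ 1])
  next
    case True
    then obtain S0 q0 where 0: "good S0 q0" "x = (coset ` S0, coset q0)"
      by blast
    obtain c r where r: "0 < r" "ball c r \<subseteq> convex hull (corners :: (real ^ 'd) set)"
      by (rule interior_corners)
    have "q0 \<in> interior (convex hull S0 + U)"
      using 0 by (simp add: good_def)
    then obtain e where e: "0 < e" "ball q0 e \<subseteq> convex hull S0 + U"
      by (auto simp: mem_interior)
    \<comment> \<open>This keeps \<open>q0 + t *\<^sub>R (q0 - c)\<close> in the ball about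
      \<open>q0\<close>; the summand 1 covers \<open>q0 = c\<close>.\<close>
    define t where "t = e / (2 * (norm (q0 - c) + 1))"
    have "0 < t"
      using e by (simp add: t_def add_nonneg_pos)
    have "t * norm (q0 - c) < e"
      using e by (simp add: t_def field_simps add_pos_nonneg)
    then have q0: "q0 + t *\<^sub>R (q0 - c) \<in> convex hull S0 + U"
      using e(2) \<open>0 < t\<close> by (auto simp: dist_norm subset_iff)
    \<comment> \<open>A homothety of ratio \<open>t / (1 + t)\<close> takes \<open>ball c r\<close>
      to a ball of this radius, whatever its centre \<open>p\<close> below.\<close>
    define R where "R = t * r / (1 + t)"
    have "0 < R"
      using \<open>0 < t\<close> r by (simp add: R_def)
    moreover have "Q x R"
      unfolding Q_def 0(2) case_prod_conv
    proof (intro allI impI)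
      fix S q assume S: "good S q" "coset ` S = coset ` S0" "coset q = coset q0"
      have "S0 \<subseteq> S + U"
      proof
        fix s assume "s \<in> S0"
        then obtain s' where "s' \<in> S" "coset s = coset s'"
          using S(2) by (metis imageE imageI)
        then have "s - s' \<in> U"
          using cosetI[of s] by (simp add: coset_def)
        then show "s \<in> S + U"
          using \<open>s' \<in> S\<close> set_plus_intro[of s' S "s - s'" U] by simp
      qed
      then have "q0 + t *\<^sub>R (q0 - c) \<in> convex hull S + U"
        using q0 convex_hull_plus_subset[OF U] by blast
      then obtain p u where p: "p \<in> convex hull S" "u \<in> U" "q0 + t *\<^sub>R (q0 - c) = p + u"
        by (auto elim: set_plus_elim)
      have q: "q0 - q \<in> U"
        using cosetI[of q0] unfolding S(3)[symmetric] by (simp add: coset_def)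
      \<comment> \<open>The image of \<open>c\<close> under the homothety with centre
        \<open>p\<close>; it agrees with \<open>q0\<close> modulo \<open>U\<close> because
        \<open>p\<close> agrees with \<open>q0 + t *\<^sub>R (q0 - c)\<close>. Below,
        \<open>w\<close> is the preimage of \<open>z\<close>.\<close>
      define y where "y = (1 / (1 + t)) *\<^sub>R (p + t *\<^sub>R c)"
      have "p + t *\<^sub>R c = (1 + t) *\<^sub>R q0 - u"
        using p(3) by (simp add: algebra_simps)
      then have "y = (1 / (1 + t)) *\<^sub>R ((1 + t) *\<^sub>R q0 - u)"
        by (simp add: y_def)
      also have "\<dots> = q0 - (1 / (1 + t)) *\<^sub>R u"
        using \<open>0 < t\<close> by (simp add: scaleR_diff_right)
      finally have "y - q = (q0 - q) - (1 / (1 + t)) *\<^sub>R u"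
        by simp
      also have "\<dots> \<in> U"
        by (rule subspace_diff[OF U q subspace_scale[OF U p(2)]])
      finally have "y - q \<in> U" .
      moreover have "ball y R \<subseteq> convex hull S"
      proof
        fix z assume z: "z \<in> ball y R"
        define w where "w = c + ((1 + t) / t) *\<^sub>R (z - y)"
        have "norm (z - y) < R"
          using z by (simp add: dist_norm norm_minus_commute)
        then have "((1 + t) / t) * norm (z - y) < r"
          using \<open>0 < t\<close> by (simp add: R_def field_simps)
        then have "w \<in> ball c r"
          using \<open>0 < t\<close> by (simp add: w_def dist_norm)
        then have "w \<in> convex hull S"
          using r(2) S(1) hull_mono[of corners S convex] by (auto simp: good_def)
        then have "(1 / (1 + t)) *\<^sub>R p + (t / (1 + t)) *\<^sub>R w \<in> convex hull S"
          using p(1) \<open>0 < t\<close> by (intro convexD convex_convex_hull) (auto simp: field_simps)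
        also have "(1 / (1 + t)) *\<^sub>R p + (t / (1 + t)) *\<^sub>R w = y + (z - y)"
          using \<open>0 < t\<close> by (simp add: w_def y_def scaleR_add_right)
        finally show "z \<in> convex hull S"
          by simp
      qed
      ultimately show "\<exists>y. y - q \<in> U \<and> ball y R \<subseteq> convex hull S"
        by blast
    qed
    ultimately show ?thesis
      by blast
  qed
  moreover have "Q x R'" if "Q x R" "0 < R'" "R' \<le> R" for x R R'
  proof -
    have "ball y R' \<subseteq> ball y R" for y :: "real ^ 'd"
      using that(3) by (rule subset_ball)
    then show ?thesis
      using that(1) unfolding Q_def by (force split: prod.splits)
  qed
  ultimately obtain R where R: "0 < R" "\<And>x. x \<in> X \<Longrightarrow> Q x R"
    using ex_uniform_pos[OF finX, of Q] by blast
  show ?thesis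
  proof (intro exI[of _ R] conjI allI impI \<open>0 < R\<close>)
    fix S q
    assume S: "corners \<subseteq> S" "S \<subseteq> annih D \<inter> cbox (- 1) 1" "q \<in> annih D"
      "q \<in> interior (convex hull S + perp D)"
    then have good: "good S q"
      by (simp add: good_def U_def)
    \<comment> \<open>\<open>q\<close> may lie outside the cube, but it is congruent to a point
      \<open>p\<close> of the hull, so its coset still occurs in \<open>X\<close>.\<close>
    have "q \<in> convex hull S + U"
      using S(4) interior_subset by (auto simp: U_def)
    then obtain p u where p: "p \<in> convex hull S" "u \<in> U" "q = p + u"
      by (auto elim: set_plus_elim)
    have "convex hull S \<subseteq> cbox (- 1) 1"
      using S(2) by (intro hull_minimal) auto
    moreover have "p \<in> annih D"
      using annih_diff[OF S(3), of u] p perp_subset_annih[of D] by (auto simp: U_def)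
    moreover have "coset q = coset p"
    proof -
      have "z - q = z - p - u" "z - p = z - q + u" for z
        using p(3) by auto
      then show ?thesis
        using p(2) U subspace_diff subspace_add unfolding coset_def by (metis (no_types, lifting))
    qed
    ultimately have "(coset ` S, coset q) \<in> X"
      using S(2) p(1) by (auto simp: X_def)
    from R(2)[OF this] show "\<exists>y. y - q \<in> perp D \<and> ball y R \<subseteq> convex hull S"
      using good by (auto simp: Q_def U_def)
  qed
qed

section \<open>Stabilization of the subspaces orthogonal to short dual vectors\<close>

text \<open>The polytope is given through a set of lattice points generating it, since
  \<open>uniform_depth\<close> compares such sets modulo a subspace.\<close>

definition normalized :: "(real ^ 'd) set \<Rightarrow> (real ^ 'd) set \<Rightarrow> bool" where
  "normalized \<Lambda> S \<longleftrightarrow> superlattice \<Lambda> \<and> corners \<subseteq> S \<and> S \<subseteq> \<Lambda> \<inter> cbox (- 1) 1 \<and>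
     interior (convex hull S) \<inter> \<Lambda> = {}"

text \<open>Hollowness of the image of \<open>P\<close> along \<open>v\<close>, stated without a
  quotient: the cylinder \<open>P + span {v}\<close> is the preimage of that image.\<close>

definition hollow_direction :: "(real ^ 'd) set \<Rightarrow> (real ^ 'd) set \<Rightarrow> real ^ 'd \<Rightarrow> bool" where
  "hollow_direction \<Lambda> P v \<longleftrightarrow> v \<in> \<Lambda> \<and> v \<noteq> 0 \<and> interior (P + span {v}) \<inter> \<Lambda> = {}"

text \<open>If the image of the hull modulo \<open>U\<close> had an interior lattice point,
  represented by \<open>q\<close>, the hull would contain a ball of radius \<open>R\<close> about a
  point \<open>y\<close> congruent to \<open>q\<close>, and a lattice vector of \<open>U\<close>
  close to \<open>y - q\<close> would move \<open>q\<close> into it. A nonzero lattice vector of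
  \<open>U\<close> then serves as \<open>v\<close>.\<close>

lemma hollow_direction_if_stable:
  fixes n :: nat
  shows "\<exists>n'\<ge>n. \<forall>\<Lambda> S :: (real ^ 'd) set. normalized \<Lambda> S \<longrightarrow>
    perp (dual_box n' \<Lambda>) = perp (dual_box n \<Lambda>) \<longrightarrow> perp (dual_box n \<Lambda>) \<noteq> {0} \<longrightarrow>
    (\<exists>v. hollow_direction \<Lambda> (convex hull S) v)"
proof -
  define Q where "Q D R \<longleftrightarrow> (\<forall>S q. corners \<subseteq> S \<longrightarrow> S \<subseteq> annih D \<inter> cbox (- 1) 1 \<longrightarrow> q \<in> annih D \<longrightarrow>
    q \<in> interior (convex hull S + perp D) \<longrightarrow> (\<exists>y. y - q \<in> perp D \<and> ball y R \<subseteq> convex hull S))"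
    for D :: "(real ^ 'd) set" and R
  \<comment> \<open>The radius has to be fixed before \<open>n'\<close> and
    \<open>\<Lambda>\<close>; this is possible since \<open>int_box n\<close> has finitely many
    subsets.\<close>
  have "\<exists>R>0. \<forall>D\<in>Pow (int_box n). Q D R"
  proof (rule ex_uniform_pos)
    show "finite (Pow (int_box n :: (real ^ 'd) set))"
      by (simp add: finite_int_box)
    show "\<exists>R>0. Q D R" if "D \<in> Pow (int_box n)" for D
      using uniform_depth[of D] that finite_subset[OF _ finite_int_box] unfolding Q_def by blast
    show "Q D R'" if "Q D R" "0 < R'" "R' \<le> R" for D R R'
    proof -
      have "ball y R \<subseteq> C \<Longrightarrow> ball y R' \<subseteq> C" for y :: "real ^ 'd" and C
        using subset_ball[OF that(3)] by (rule order_trans)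
      then show ?thesis
        using that(1) unfolding Q_def by (elim all_forward imp_forward ex_forward conj_forward)
    qed
  qed
  then obtain R where R: "0 < R" "\<And>D. D \<subseteq> int_box n \<Longrightarrow> Q D R"
    by auto
  define d where "d = real CARD('d)"
  have d: "d \<ge> 1"
    by (simp add: d_def Suc_le_eq)
  \<comment> \<open>The factor \<open>d\<close> passes from coordinates to norms and inner products;
    \<open>1 / (real n + 2)\<close> makes inner products with vectors of \<open>int_box n\<close>
    smaller than 1.\<close>
  define r where "r = min R (1 / (real n + 2)) / d"
  have r: "0 < r" "d * r \<le> R" "d * (real n * r) < 1" "d * r < 1"
  proof -
    have *: "d * r = min R (1 / (real n + 2))"
      using d by (simp add: r_def)
    show "0 < r"
      using d R by (simp add: r_def)
    show "d * r \<le> R"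
      using * by simp
    have "d * r \<le> 1 / (real n + 2)"
      using * by simp
    also have "\<dots> < 1"
      by simp
    finally show "d * r < 1" .
    have "d * (real n * r) = real n * min R (1 / (real n + 2))"
      using * by (simp add: algebra_simps)
    also have "\<dots> \<le> real n * (1 / (real n + 2))"
      by (intro mult_left_mono) auto
    also have "\<dots> < 1"
      by simp
    finally show "d * (real n * r) < 1" .
  qed
  obtain n' where n': "n \<le> n'" "\<And>\<Lambda> g :: real ^ 'd. superlattice \<Lambda> \<Longrightarrow> g \<in> annih (dual_box n' \<Lambda>) \<Longrightarrow>
      \<exists>x\<in>\<Lambda>. \<forall>i. \<bar>g $ i - x $ i\<bar> < r"
    using eventually_happens'[OF _ eventually_conj[OF dense_in_annih[OF r(1), where 'd = 'd] eventually_ge_at_top[of n]]]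
    by auto
  show ?thesis
  proof (intro exI[of _ n'] conjI allI impI n'(1))
    fix \<Lambda> S :: "(real ^ 'd) set"
    assume norm: "normalized \<Lambda> S"
    define U where "U = perp (dual_box n \<Lambda>)"
    assume stable: "perp (dual_box n' \<Lambda>) = perp (dual_box n \<Lambda>)" and "perp (dual_box n \<Lambda>) \<noteq> {0}"
    have \<Lambda>: "superlattice \<Lambda>" and S: "corners \<subseteq> S" "S \<subseteq> \<Lambda>" "S \<subseteq> cbox (- 1) 1"
      and hol: "interior (convex hull S) \<inter> \<Lambda> = {}"
      using norm by (auto simp: normalized_def)
    have \<Lambda>_annih: "\<Lambda> \<subseteq> annih (dual_box n \<Lambda>)"
      by (auto simp: dual_box_def annih_def inner_commute)
    have U: "subspace U"
      by (simp add: U_def subspace_perp)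
    have approx: "\<exists>x\<in>\<Lambda> \<inter> U. norm (u - x) < d * r" if u: "u \<in> U" for u
    proof -
      \<comment> \<open>Stability enters here: \<open>u\<close> is orthogonal to all of
        \<open>dual_box n' \<Lambda>\<close>, not only to
        \<open>dual_box n \<Lambda>\<close>.\<close>
      have "u \<in> annih (dual_box n' \<Lambda>)"
        using u perp_subset_annih stable by (auto simp: U_def)
      then obtain x where x: "x \<in> \<Lambda>" "\<And>i. \<bar>u $ i - x $ i\<bar> < r"
        using n'(2)[OF \<Lambda>] by blast
      \<comment> \<open>The approximating lattice point lies in \<open>U\<close> itself, as
        \<open>m \<bullet> x\<close> is an integer of absolute value below 1.\<close>
      have "m \<bullet> x = 0" if m: "m \<in> dual_box n \<Lambda>" for m
      proof -
        have "m \<bullet> u = 0"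
          using u m by (simp add: U_def perp_def)
        then have "m \<bullet> x = - (m \<bullet> (u - x))"
          by (simp add: inner_diff_right)
        moreover have "\<bar>m \<bullet> (u - x)\<bar> \<le> d * (real n * r)"
          unfolding d_def using m x(2)
          by (intro abs_inner_le) (auto simp: dual_box_def int_box_def less_imp_le)
        ultimately have "\<bar>m \<bullet> x\<bar> < 1"
          using r(3) by simp
        moreover have "m \<bullet> x \<in> \<int>"
          using m x(1) by (auto simp: dual_box_def annih_def inner_commute)
        ultimately show ?thesis
          using Ints_nonzero_abs_less1 by blast
      qed
      then have "x \<in> U"
        by (simp add: U_def perp_def)
      moreover have "norm (u - x) < d * r"
      proof -
        have "norm (u - x) \<le> (\<Sum>i\<in>UNIV. \<bar>(u - x) $ i\<bar>)"
          by (rule norm_le_l1_cart)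
        also have "\<dots> < (\<Sum>i\<in>(UNIV :: 'd set). r)"
          using x(2) by (intro sum_strict_mono) auto
        finally show ?thesis
          by (simp add: d_def)
      qed
      ultimately show ?thesis
        using x(1) by auto
    qed
    obtain v where v: "v \<in> \<Lambda>" "v \<in> U" "v \<noteq> 0"
    proof -
      obtain u where u: "u \<in> U" "u \<noteq> 0"
        using \<open>perp (dual_box n \<Lambda>) \<noteq> {0}\<close> subspace_0[OF U] by (auto simp: U_def)
      \<comment> \<open>For a unit vector, an approximation at distance below 1 cannot be 0.\<close>
      then have "(1 / norm u) *\<^sub>R u \<in> U"
        using U by (simp add: subspace_scale)
      then obtain x where x: "x \<in> \<Lambda>" "x \<in> U" "norm ((1 / norm u) *\<^sub>R u - x) < d * r"
        using approx by blast
      then have "x \<noteq> 0"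
        using u r(4) by auto
      then show thesis
        using that x by blast
    qed
    have "interior (convex hull S + U) \<inter> \<Lambda> = {}"
    proof (rule ccontr)
      assume "interior (convex hull S + U) \<inter> \<Lambda> \<noteq> {}"
      then obtain q where q: "q \<in> \<Lambda>" "q \<in> interior (convex hull S + U)"
        by auto
      have depth: "Q (dual_box n \<Lambda>) R"
        by (rule R(2)) (auto simp: dual_box_def)
      have "S \<subseteq> annih (dual_box n \<Lambda>) \<inter> cbox (- 1) 1" "q \<in> annih (dual_box n \<Lambda>)"
        using S q \<Lambda>_annih by auto
      from depth[unfolded Q_def, rule_format, OF S(1) this q(2)[unfolded U_def]]
      obtain y where y: "y - q \<in> U" "ball y R \<subseteq> convex hull S"
        by (auto simp: U_def)
      obtain x where x: "x \<in> \<Lambda>" "norm (y - q - x) < d * r"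
        using approx[OF y(1)] by blast
      have "q + x \<in> ball y R"
        using x(2) r(2) by (simp add: dist_norm diff_diff_eq)
      then have "q + x \<in> interior (convex hull S)"
        using interior_maximal[OF y(2)] by auto
      moreover have "q + x \<in> \<Lambda>"
        using superlatticeD(4)[OF \<Lambda> q(1) x(1)] .
      ultimately show False
        using hol by auto
    qed
    moreover have "convex hull S + span {v} \<subseteq> convex hull S + U"
      using v U by (intro set_plus_mono2 span_minimal) auto
    ultimately have "interior (convex hull S + span {v}) \<inter> \<Lambda> = {}"
      using interior_mono by blast
    then show "\<exists>v. hollow_direction \<Lambda> (convex hull S) v"
      using v by (auto simp: hollow_direction_def)
  qed
qed

text \<open>Without a hollow direction, a nonzero subspace cannot stay the same when
  \<open>n\<close> is replaced by the \<open>n'\<close> of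
  \<open>hollow_direction_if_stable\<close>. So its dimension drops at each step until it is zero,
  after at most \<open>CARD('d)\<close> steps.\<close>

lemma perp_trivial_if_no_hollow_direction:
  "\<exists>n. \<forall>\<Lambda> S :: (real ^ 'd) set. normalized \<Lambda> S \<longrightarrow>
    (\<forall>v. \<not> hollow_direction \<Lambda> (convex hull S) v) \<longrightarrow> perp (dual_box n \<Lambda>) = {0}"
proof -
  have "\<exists>n. \<forall>\<Lambda> S :: (real ^ 'd) set. normalized \<Lambda> S \<longrightarrow>
    (\<forall>v. \<not> hollow_direction \<Lambda> (convex hull S) v) \<longrightarrow>
    perp (dual_box n \<Lambda>) = {0} \<or> dim (perp (dual_box n \<Lambda>)) + k \<le> CARD('d)" for k
  proof (induction k)
    case 0
    show ?case
      by (auto intro: dim_subset_UNIV_cart)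
  next
    case (Suc k)
    then obtain n where n: "\<And>\<Lambda> S :: (real ^ 'd) set. normalized \<Lambda> S \<Longrightarrow>
        \<forall>v. \<not> hollow_direction \<Lambda> (convex hull S) v \<Longrightarrow>
        perp (dual_box n \<Lambda>) = {0} \<or> dim (perp (dual_box n \<Lambda>)) + k \<le> CARD('d)"
      by blast
    obtain n' where n': "n \<le> n'" "\<And>\<Lambda> S :: (real ^ 'd) set. normalized \<Lambda> S \<Longrightarrow>
        perp (dual_box n' \<Lambda>) = perp (dual_box n \<Lambda>) \<Longrightarrow> perp (dual_box n \<Lambda>) \<noteq> {0} \<Longrightarrow>
        \<exists>v. hollow_direction \<Lambda> (convex hull S) v"
      using hollow_direction_if_stable[of n, where 'd = 'd] by blast
    show ?case
    proof (intro exI[of _ n'] allI impI)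
      fix \<Lambda> S :: "(real ^ 'd) set"
      assume norm: "normalized \<Lambda> S" and no: "\<forall>v. \<not> hollow_direction \<Lambda> (convex hull S) v"
      have "dual_box n \<Lambda> \<subseteq> dual_box n' \<Lambda>"
        using int_box_mono[OF n'(1)] by (auto simp: dual_box_def)
      then have sub: "perp (dual_box n' \<Lambda>) \<subseteq> perp (dual_box n \<Lambda>)"
        by (auto simp: perp_def)
      have zero: "0 \<in> perp (dual_box n' \<Lambda>)"
        by (simp add: perp_def)
      show "perp (dual_box n' \<Lambda>) = {0} \<or> dim (perp (dual_box n' \<Lambda>)) + Suc k \<le> CARD('d)"
      proof (cases "perp (dual_box n \<Lambda>) = {0}")
        case True
        then show ?thesis
          using sub zero by auto
      next
        case False
        then have "perp (dual_box n' \<Lambda>) \<subset> perp (dual_box n \<Lambda>)"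
          using n'(2)[OF norm] no sub by (metis psubsetI)
        then have "dim (perp (dual_box n' \<Lambda>)) < dim (perp (dual_box n \<Lambda>))"
          by (intro dim_psubset) (simp only: span_eq_iff[THEN iffD2, OF subspace_perp])
        then show ?thesis
          using n[OF norm no] False by simp
      qed
    qed
  qed
  from this[of "CARD('d)"] obtain n where n: "\<And>\<Lambda> S :: (real ^ 'd) set. normalized \<Lambda> S \<Longrightarrow>
      \<forall>v. \<not> hollow_direction \<Lambda> (convex hull S) v \<Longrightarrow>
      perp (dual_box n \<Lambda>) = {0} \<or> dim (perp (dual_box n \<Lambda>)) + CARD('d) \<le> CARD('d)"
    by blast
  show ?thesis
  proof (intro exI[of _ n] allI impI)
    fix \<Lambda> S :: "(real ^ 'd) set"
    assume "normalized \<Lambda> S" "\<forall>v. \<not> hollow_direction \<Lambda> (convex hull S) v"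
    from n[OF this] have "perp (dual_box n \<Lambda>) = {0} \<or> perp (dual_box n \<Lambda>) \<subseteq> {0}"
      by (simp add: dim_eq_0)
    then show "perp (dual_box n \<Lambda>) = {0}"
      using subspace_0[OF subspace_perp] by blast
  qed
qed

section \<open>Projections and normalization\<close>

text \<open>The orthogonal projection \<open>L\<close> along \<open>v\<close> has kernel
  \<open>span {v}\<close>, the affine hull of the lattice points 0 and \<open>v\<close>. An interior
  lattice point of the image would come from a lattice point interior to the cylinder.\<close>

lemma projects_onto_hollow_if_hollow_direction:
  fixes P :: "(real ^ 'd) set"
  assumes P: "hollow_lattice_d_polytope P" and v: "hollow_direction int_lattice P v"
  shows "projects_onto_hollow P"
proof -
  have v0: "v \<noteq> 0" "v \<in> int_lattice" "interior (P + span {v}) \<inter> int_lattice = {}"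
    using v by (auto simp: hollow_direction_def)
  define V where "V = {x. v \<bullet> x = 0}"
  define L where "L x = x - ((v \<bullet> x) / (v \<bullet> v)) *\<^sub>R v" for x
  have L: "linear L"
    by (rule linearI) (auto simp: L_def inner_add_right add_divide_distrib scaleR_left_distrib scaleR_diff_right)
  have V: "subspace V"
    unfolding V_def by (rule subspace_hyperplane)
  have L_id: "L x = x" if "x \<in> V" for x
    using that by (simp add: L_def V_def)
  have "L x \<in> V" for x
    using v0(1) by (simp add: L_def V_def inner_diff_right)
  then have range_L: "range L = V"
    using L_id by (auto simp: image_iff) metis
  have ker: "{x. L x = 0} = span {v}"
  proof -
    have "L (a *\<^sub>R v) = 0" for a
      using v0(1) by (simp add: L_def)
    then show ?thesis
      by (auto simp: span_singleton L_def)
  qed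
  have "affine hull {0, v} \<subseteq> affine hull (span {v} \<inter> int_lattice)"
    using v0(2) by (intro hull_mono) (auto simp: span_base span_zero int_lattice_def)
  moreover have "affine hull {0, v} = span {v}"
    using affine_hull_insert_span_gen[of 0 "{v}"] by simp
  moreover have "affine hull (span {v} \<inter> int_lattice) \<subseteq> span {v}"
    by (intro hull_minimal) (auto simp: subspace_imp_affine)
  ultimately have ker_hull: "affine hull ({x. L x = 0} \<inter> int_lattice) = {x. L x = 0}"
    unfolding ker by blast
  have proj: "lattice_projection L V"
    unfolding lattice_projection_def using V L range_L ker_hull
    by (auto intro!: exI[of _ L] exI[of _ 0])
  have dimV: "dim V = CARD('d) - 1"
    unfolding V_def using dim_hyperplane[OF v0(1)] by simp
  have "lattice_polytope int_lattice P" and dimP: "aff_dim P = int (DIM(real ^ 'd))"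
    using P by (auto simp: hollow_full_lattice_polytope_def)
  then obtain S where S: "finite S" "S \<subseteq> int_lattice" "P = convex hull S"
    by (auto simp: lattice_polytope_def)
  have "L ` P = convex hull (L ` S)"
    by (simp add: S(3) convex_hull_linear_image[OF L])
  then have "lattice_polytope (L ` int_lattice) (L ` P)"
    using S by (auto simp: lattice_polytope_def intro!: exI[of _ "L ` S"])
  moreover have "aff_dim (L ` P) = int (dim V)"
  proof -
    have "affine hull P = UNIV"
      by (rule aff_dim_eq_full[THEN iffD1, OF dimP])
    then have "affine hull (L ` P) = V"
      using affine_hull_linear_image[OF L[unfolded linear_conv_bounded_linear], of P] range_L by simp
    then show ?thesis
      by (metis V aff_dim_affine_hull aff_dim_subspace)
  qed
  moreover have "top_of_set V interior_of (L ` P) \<inter> L ` int_lattice = {}"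
  proof (rule ccontr)
    assume "top_of_set V interior_of (L ` P) \<inter> L ` int_lattice \<noteq> {}"
    then obtain z T where z: "z \<in> int_lattice" "openin (top_of_set V) T" "L z \<in> T" "T \<subseteq> L ` P"
      by (auto simp: interior_of_def)
    then obtain T' where T': "open T'" "T = V \<inter> T'"
      by (auto simp: openin_open)
    have "open (L -` T')"
      using T'(1) L by (simp add: continuous_open_vimage linear_continuous_at linear_linear)
    moreover have "L -` T' \<subseteq> P + span {v}"
    proof
      fix x assume "x \<in> L -` T'"
      then have "L x \<in> T"
        using T'(2) range_L by auto
      then obtain p where p: "p \<in> P" "L x = L p"
        using z(4) by auto
      then have "x - p \<in> span {v}"
        unfolding ker[symmetric] using linear_diff[OF L] by simp
      then show "x \<in> P + span {v}"
        using set_plus_intro[OF p(1), of "x - p" "span {v}"] by simp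
    qed
    ultimately have "z \<in> interior (P + span {v})"
      using z(3) T'(2) by (intro interiorI[of "L -` T'"]) auto
    then show False
      using z(1) v0(3) by auto
  qed
  moreover have "L ` P \<subseteq> V"
    using range_L by auto
  ultimately have "hollow_full_lattice_polytope V (L ` int_lattice) (L ` P)"
    by (simp add: hollow_full_lattice_polytope_def hollow_def)
  then show ?thesis
    unfolding projects_onto_hollow_def using proj dimV by blast
qed

section \<open>Normalization by a lattice simplex\<close>

lemma matrix_inverse_apply:
  fixes A B :: "real ^ 'd ^ 'd"
  assumes "A ** B = mat 1"
  shows "A *v (B *v x) = x"
  by (simp add: assms matrix_vector_mul_assoc)

lemma interior_affine_image:
  fixes A B :: "real ^ 'd ^ 'd"
  assumes "A ** B = mat 1"
  shows "interior ((\<lambda>x. B *v x + b) ` X) = (\<lambda>x. B *v x + b) ` interior X"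
proof -
  have "inj ((*v) B)"
    by (metis assms injI matrix_inverse_apply)
  have *: "(\<lambda>x. B *v x + b) ` Y = (+) b ` (*v) B ` Y" for Y
    by (simp add: image_image add.commute)
  show ?thesis
    unfolding * interior_translation
    by (simp add: interior_injective_linear_image[OF matrix_vector_mul_linear \<open>inj ((*v) B)\<close>])
qed

lemma int_lattice_add: "x \<in> int_lattice \<Longrightarrow> y \<in> int_lattice \<Longrightarrow> x + y \<in> int_lattice"
  and int_lattice_diff: "x \<in> int_lattice \<Longrightarrow> y \<in> int_lattice \<Longrightarrow> x - y \<in> int_lattice"
  by (auto simp: int_lattice_def)

text \<open>As \<open>b\<close> is integral, the affine map takes the transformed lattice back to
  \<open>int_lattice\<close>, and the cylinder over \<open>K\<close> along \<open>v\<close> to the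
  one along \<open>B *v v\<close>.\<close>

lemma hollow_direction_affine_image:
  fixes A B :: "real ^ 'd ^ 'd"
  assumes AB: "A ** B = mat 1" "B ** A = mat 1" and b: "b \<in> int_lattice"
    and v: "hollow_direction ((*v) A ` int_lattice) K v"
  shows "hollow_direction int_lattice ((\<lambda>x. B *v x + b) ` K) (B *v v)"
proof -
  note BA = matrix_inverse_apply[OF AB(2)] and AB' = matrix_inverse_apply[OF AB(1)]
  have "B *v v \<in> int_lattice"
    using v BA by (auto simp: hollow_direction_def)
  moreover have "B *v v \<noteq> 0"
    using v AB'[of v] by (auto simp: hollow_direction_def)
  moreover have "interior ((\<lambda>x. B *v x + b) ` K + span {B *v v}) \<inter> int_lattice = {}"
  proof -
    have "span {B *v v} = (*v) B ` span {v}"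
      using linear_span_image[OF matrix_vector_mul_linear, of B "{v}"] by simp
    then have "(\<lambda>x. B *v x + b) ` K + span {B *v v} = (\<lambda>x. B *v x + b) ` (K + span {v})"
      by (force simp: set_plus_def matrix_vector_right_distrib)
    moreover have "B *v x + b \<notin> int_lattice" if x: "x \<in> interior (K + span {v})" for x
    proof
      assume "B *v x + b \<in> int_lattice"
      then have "B *v x \<in> int_lattice"
        using int_lattice_diff[OF _ b] by force
      then have "x \<in> (*v) A ` int_lattice"
        using AB'[of x] by (metis image_eqI)
      then show False
        using x v by (auto simp: hollow_direction_def)
    qed
    ultimately show ?thesis
      by (auto simp: interior_affine_image[OF AB(1)])
  qed
  ultimately show ?thesis
    by (simp add: hollow_direction_def)
qed

lemma int_matrix_vector_mult:
  fixes A :: "real ^ 'd ^ 'd"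
  assumes "\<And>i j. A $ i $ j \<in> \<int>" "x \<in> int_lattice"
  shows "A *v x \<in> int_lattice"
  using assms by (auto simp: int_lattice_def matrix_vector_mult_def intro!: Ints_sum Ints_mult)

text \<open>
  The columns of \<open>B\<close> are edge vectors at \<open>b\<close> of a lattice simplex with vertices in \<open>P\<close>. It is
  chosen with \<open>\<bar>det B\<bar>\<close> maximal, so that by Cramer's rule all vertices of \<open>P\<close> have coordinates in
  \<open>[-1,1]\<close> with respect to the columns.
\<close>

lemma ex_normalized:
  fixes P :: "(real ^ 'd) set"
  assumes "hollow_lattice_d_polytope P"
  obtains A B :: "real ^ 'd ^ 'd" and b S where "A ** B = mat 1" "B ** A = mat 1" "b \<in> int_lattice"
    "normalized ((*v) A ` int_lattice) S" "P = (\<lambda>x. B *v x + b) ` (convex hull S)"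
proof -
  have "lattice_polytope int_lattice P" and dimP: "aff_dim P = int (DIM(real ^ 'd))"
    and hol: "interior P \<inter> int_lattice = {}"
    using assms by (auto simp: hollow_full_lattice_polytope_def hollow_UNIV)
  then obtain S0 where S0: "finite S0" "S0 \<subseteq> int_lattice" "P = convex hull S0"
    by (auto simp: lattice_polytope_def)
  have aff: "affine hull S0 = UNIV"
    using dimP by (simp add: S0(3) aff_dim_eq_full[symmetric] aff_dim_convex_hull)
  then have "S0 \<noteq> {}"
    by auto
  then obtain b where b: "b \<in> S0"
    by auto
  define S1 where "S1 = (\<lambda>x. x - b) ` S0"
  have S1: "finite S1" "S1 \<subseteq> int_lattice" "0 \<in> S1"
    using S0 b int_lattice_diff by (auto simp: S1_def image_iff)
  have P_S1: "P = (\<lambda>x. x + b) ` (convex hull S1)"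
  proof -
    have "S0 = (+) b ` S1"
      by (simp add: S1_def image_image)
    moreover have "(\<lambda>x. x + b) = (+) b"
      by (auto simp: add.commute)
    ultimately show ?thesis
      by (simp only: S0(3) convex_hull_translation)
  qed
  have span: "span S1 = UNIV"
  proof -
    have "x \<in> (+) b ` span S1" if "x \<in> S0" for x
      using that span_base[of "x - b" S1] by (auto simp: S1_def image_iff intro!: bexI[of _ "x - b"])
    then have "affine hull S0 \<subseteq> (+) b ` span S1"
      by (intro hull_minimal) (auto simp: subspace_imp_affine affine_translation[symmetric])
    then have "x + b \<in> (+) b ` span S1" for x
      using aff by auto
    then show ?thesis
      by (auto simp: image_iff)
  qed
  define vol where "vol w = \<bar>det ((\<chi> i. w i) :: real ^ 'd ^ 'd)\<bar>" for w
  \<comment> \<open>A basis inside \<open>S1\<close> ensures that the maximal volume is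
    nonzero.\<close>
  obtain w0 where w0: "\<And>i. w0 i \<in> S1" "vol w0 \<noteq> 0"
  proof -
    obtain E where E: "E \<subseteq> S1" "independent E" "S1 \<subseteq> span E" "card E = dim S1"
      by (rule basis_exists)
    have "span E = UNIV"
      using E(1,3) span by (metis span_mono span_span top.extremum_uniqueI)
    have "dim S1 = CARD('d)"
      using span by (metis dim_UNIV dim_span DIM_cart DIM_real mult.right_neutral)
    then obtain w0 :: "'d \<Rightarrow> real ^ 'd" where w0: "bij_betw w0 UNIV E"
      using E(4) independent_imp_finite[OF E(2)] finite_same_card_bij[of "UNIV :: 'd set" E] by auto
    have "rows (\<chi> i. w0 i) = E"
      using w0 by (auto simp: rows_def row_def bij_betw_def vec_nth_inverse)
    then have "invertible (\<chi> i. w0 i)"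
      using \<open>span E = UNIV\<close> matrix_left_invertible_span_rows[of "\<chi> i. w0 i"] invertible_left_inverse
      by metis
    then show thesis
      using w0 E(1) by (intro that[of w0]) (auto simp: vol_def invertible_det_nz bij_betw_def)
  qed
  define W where "W = PiE (UNIV :: 'd set) (\<lambda>_. S1)"
  have W: "finite (vol ` W)" "vol ` W \<noteq> {}"
    using S1 w0(1) by (auto simp: W_def finite_PiE)
  obtain w where w: "w \<in> W" "vol w = Max (vol ` W)"
    using Max_in[OF W] by auto
  have max: "vol w' \<le> vol w" if "\<And>i. w' i \<in> S1" for w'
    unfolding w(2) using that W by (intro Max_ge) (auto simp: W_def)
  define B where "B = transpose (\<chi> i. w i)"
  have det_B: "\<bar>det B\<bar> = vol w" "det B \<noteq> 0"
    using max[OF w0(1)] w0(2) by (auto simp: B_def vol_def)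
  obtain A where AB: "A ** B = mat 1" "B ** A = mat 1"
    using det_B(2) unfolding invertible_det_nz[symmetric] invertible_def by blast
  note BA' = matrix_inverse_apply[OF AB(2)] and AB' = matrix_inverse_apply[OF AB(1)]
  have w_S1: "w i \<in> S1" for i
    using w(1) by (auto simp: W_def)
  have B_int: "B $ i $ j \<in> \<int>" for i j
    using w_S1[of j] S1(2) by (auto simp: B_def transpose_def int_lattice_def)
  have B_axis: "B *v axis i 1 = w i" for i
    by (simp add: B_def matrix_vector_mult_basis column_def transpose_def)
  define S where "S = (*v) A ` S1"
  let ?\<Lambda> = "(*v) A ` int_lattice"
  have "superlattice ?\<Lambda>"
    unfolding superlattice_def
  proof (intro conjI ballI)
    show "int_lattice \<subseteq> ?\<Lambda>"
      using int_matrix_vector_mult[OF B_int] AB' by (metis image_eqI subsetI)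
    show "x - y \<in> ?\<Lambda>" if "x \<in> ?\<Lambda>" "y \<in> ?\<Lambda>" for x y
      using that by (auto simp: matrix_vector_mult_diff_distrib[symmetric] intro!: imageI int_lattice_diff)
    \<comment> \<open>A bound for the coordinates of \<open>B *v x\<close> with \<open>x\<close> in
      the unit cube, so these \<open>x\<close> come from finitely many integer vectors.\<close>
    define c where "c = real CARD('d) * (norm B * 1)"
    have "?\<Lambda> \<inter> {x. \<forall>i. 0 \<le> x $ i \<and> x $ i < 1} \<subseteq> (*v) A ` {x \<in> int_lattice. \<forall>i. \<bar>x $ i\<bar> \<le> c}"
    proof
      fix x assume x: "x \<in> ?\<Lambda> \<inter> {x. \<forall>i. 0 \<le> x $ i \<and> x $ i < 1}"
      have "\<bar>(B *v x) $ i\<bar> \<le> c" for i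
      proof -
        have "\<bar>B $ i $ j\<bar> \<le> norm B" for j
          by (rule order_trans[OF component_le_norm_cart Finite_Cartesian_Product.norm_nth_le])
        moreover have "\<bar>x $ j\<bar> \<le> 1" for j
        proof -
          have "0 \<le> x $ j" "x $ j < 1"
            using x by auto
          then show ?thesis
            by simp
        qed
        ultimately show ?thesis
          unfolding c_def matrix_vector_mul_component by (intro abs_inner_le) auto
      qed
      then have "B *v x \<in> {x \<in> int_lattice. \<forall>i. \<bar>x $ i\<bar> \<le> c}"
        using x BA' by auto
      then show "x \<in> (*v) A ` {x \<in> int_lattice. \<forall>i. \<bar>x $ i\<bar> \<le> c}"
        by (intro image_eqI[of x _ "B *v x"]) (simp_all only: AB')
    qed
    then show "finite (?\<Lambda> \<inter> {x. \<forall>i. 0 \<le> x $ i \<and> x $ i < 1})"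
      by (rule finite_subset) (intro finite_imageI finite_int_vec_bounded)
  qed
  moreover have "corners \<subseteq> S"
  proof -
    have "axis i 1 \<in> S" for i
      unfolding S_def using AB'[of "axis i 1"] w_S1[of i]
      by (intro image_eqI[of _ _ "w i"]) (simp_all add: B_axis)
    moreover have "0 \<in> S"
      using S1(3) by (auto simp: S_def image_iff intro!: bexI[of _ 0])
    ultimately show ?thesis
      by (auto simp: corners_def)
  qed
  moreover have "S \<subseteq> ?\<Lambda> \<inter> cbox (- 1) 1"
  proof -
    have "\<bar>(A *v p) $ k\<bar> \<le> 1" if p: "p \<in> S1" for p k
    proof -
      \<comment> \<open>The numerator in Cramer's rule is the determinant with the edge vector
        \<open>w k\<close> replaced by \<open>p\<close>, a competitor for the maximum.\<close>
      let ?M = "\<chi> i j. if j = k then p $ i else B $ i $ j"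
      have "(A *v p) $ k = det ?M / det B"
        using cramer[OF det_B(2), of "A *v p" p] BA'[of p] by (simp add: vec_eq_iff)
      moreover have "?M = transpose (\<chi> i. (w(k := p)) i)"
        by (auto simp: vec_eq_iff B_def transpose_def)
      then have "\<bar>det ?M\<bar> = vol (w(k := p))"
        by (simp add: vol_def)
      moreover have "vol (w(k := p)) \<le> \<bar>det B\<bar>"
        unfolding det_B(1) by (rule max) (use p w_S1 in auto)
      ultimately show ?thesis
        using det_B(2) by (simp add: abs_divide)
    qed
    then show ?thesis
      using S1(2) by (auto simp: S_def mem_cube)
  qed
  moreover have P_S: "P = (\<lambda>x. B *v x + b) ` (convex hull S)"
    unfolding P_S1 S_def convex_hull_linear_image[OF matrix_vector_mul_linear, symmetric]
    by (simp add: image_image BA')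
  moreover have "interior (convex hull S) \<inter> ?\<Lambda> = {}"
  proof (rule ccontr)
    assume "interior (convex hull S) \<inter> ?\<Lambda> \<noteq> {}"
    then obtain z where z: "z \<in> int_lattice" "A *v z \<in> interior (convex hull S)"
      by auto
    have "B *v (A *v z) + b \<in> interior P"
      unfolding P_S interior_affine_image[OF AB(1)] using z(2) by (rule imageI)
    moreover have "z + b \<in> int_lattice"
      using z(1) b S0(2) int_lattice_add by blast
    ultimately show False
      using hol by (auto simp: BA')
  qed
  ultimately have "normalized ?\<Lambda> S"
    by (simp add: normalized_def)
  then show thesis
    using that AB b S0(2) P_S by blast
qed

section \<open>Finiteness up to unimodular equivalence\<close>

text \<open>An element of such a lattice is an integer vector plus its fractional part, which lies
  in the cube and again in the lattice.\<close>

lemma superlattice_eqI: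
  assumes "superlattice \<Lambda>" "superlattice \<Lambda>'" "\<Lambda> \<inter> cbox (- 1) 1 = \<Lambda>' \<inter> cbox (- 1) 1"
  shows "\<Lambda> = \<Lambda>'"
proof -
  have "x \<in> \<Lambda>'" if "superlattice \<Lambda>" "superlattice \<Lambda>'" "\<Lambda> \<inter> cbox (- 1) 1 \<subseteq> \<Lambda>'" "x \<in> \<Lambda>"
    for x :: "real ^ 'd" and \<Lambda> \<Lambda>'
  proof -
    have "frac_vec x \<in> \<Lambda>"
      using superlatticeD(3)[OF that(1,4) superlatticeD(1)[OF that(1) frac_vec_diff[of x]]] by simp
    moreover have "frac_vec x \<in> cbox (- 1) 1"
      by (auto simp: mem_cube frac_vec_def less_imp_le[OF frac_lt_1])
    ultimately have "frac_vec x \<in> \<Lambda>'"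
      using that(3) by auto
    from superlatticeD(4)[OF that(2) this superlatticeD(1)[OF that(2) frac_vec_diff[of x]]]
    show ?thesis
      by simp
  qed
  then show ?thesis
    using assms by blast
qed

lemma int_matrix_if_maps_int_lattice:
  fixes A :: "real ^ 'd ^ 'd"
  assumes "\<And>x. x \<in> int_lattice \<Longrightarrow> A *v x \<in> int_lattice"
  shows "A $ i $ j \<in> \<int>"
proof -
  have "axis j 1 \<in> (int_lattice :: (real ^ 'd) set)"
    by (auto simp: int_lattice_def axis_def)
  from assms[OF this] show ?thesis
    by (auto simp: int_lattice_def matrix_vector_mult_basis column_def)
qed

text \<open>\<open>A\<close> takes \<open>int_lattice\<close> to the common lattice and
  \<open>B'\<close> takes that back to \<open>int_lattice\<close>, so \<open>B' ** A\<close> is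
  integral, and so is its inverse \<open>B ** A'\<close>.\<close>

lemma unimodularly_equivalent_if_same_normalization:
  fixes A B A' B' :: "real ^ 'd ^ 'd"
  assumes AB: "A ** B = mat 1" "B ** A = mat 1" "A' ** B' = mat 1" "B' ** A' = mat 1"
    and b: "b \<in> int_lattice" "b' \<in> int_lattice"
    and eq: "(*v) A ` int_lattice = (*v) A' ` int_lattice"
  shows "unimodularly_equivalent ((\<lambda>x. B *v x + b) ` K) ((\<lambda>x. B' *v x + b') ` K)"
proof -
  have int: "(B2 ** A1) $ i $ j \<in> \<int>"
    if inv: "B2 ** A2 = mat 1" and sub: "(*v) A1 ` int_lattice \<subseteq> (*v) A2 ` int_lattice" for A1 A2 B2 :: "real ^ 'd ^ 'd" and i j
  proof (rule int_matrix_if_maps_int_lattice)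
    fix x :: "real ^ 'd" assume "x \<in> int_lattice"
    then obtain y where "y \<in> int_lattice" "A1 *v x = A2 *v y"
      using sub by auto
    then show "(B2 ** A1) *v x \<in> int_lattice"
      using matrix_inverse_apply[OF inv, of y] by (simp add: matrix_vector_mul_assoc[symmetric])
  qed
  define M where "M = B' ** A"
  have inverse: "M ** (B ** A') = mat 1" "(B ** A') ** M = mat 1"
    unfolding M_def by (metis AB matrix_mul_assoc matrix_mul_lid)+
  have ints: "M $ i $ j \<in> \<int>" "(B ** A') $ i $ j \<in> \<int>" for i j
    unfolding M_def using int[OF AB(4)] int[OF AB(2)] eq by auto
  have "M \<in> GL_int"
    using ints inverse by (auto simp: GL_int_def intro!: exI[of _ "B ** A'"])
  moreover have "b' - M *v b \<in> int_lattice"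
    using b int_lattice_diff int_matrix_vector_mult[OF ints(1)] by blast
  moreover have "M *v (B *v x + b) + (b' - M *v b) = B' *v x + b'" for x
    unfolding M_def
    by (simp add: matrix_vector_right_distrib matrix_vector_mul_assoc[symmetric] matrix_inverse_apply[OF AB(1)])
  then have "(\<lambda>x. M *v x + (b' - M *v b)) ` (\<lambda>x. B *v x + b) ` K = (\<lambda>x. B' *v x + b') ` K"
    by (simp only: image_image)
  ultimately show ?thesis
    unfolding unimodularly_equivalent_def by blast
qed

text \<open>The cosets counted by \<open>finite_cosets\<close> are then single points.\<close>

lemma finite_annih_if_perp_trivial:
  fixes D :: "(real ^ 'd) set"
  assumes "finite D" "perp D = {0}"
  shows "finite (annih D \<inter> cbox (- 1) 1)"
proof (rule finite_imageD)
  show "finite ((\<lambda>x. {z. z - x \<in> perp D}) ` (annih D \<inter> cbox (- 1) 1))"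
    by (rule finite_cosets[OF assms(1)])
  show "inj_on (\<lambda>x. {z. z - x \<in> perp D}) (annih D \<inter> cbox (- 1) 1)"
    by (auto simp: inj_on_def assms(2))
qed

text \<open>A code is chosen for each element, and one element is kept for each code that occurs.
  \<open>R\<close> is a relation because an element may have several codes.\<close>

lemma finite_representatives:
  assumes "finite X" "\<And>x. x \<in> \<P> \<Longrightarrow> \<exists>c\<in>X. R x c"
    and "\<And>x y c. R x c \<Longrightarrow> R y c \<Longrightarrow> eqv x y"
  shows "\<exists>F\<subseteq>\<P>. finite F \<and> (\<forall>x\<in>\<P>. \<exists>y\<in>F. eqv x y)"
proof -
  obtain code where code: "\<And>x. x \<in> \<P> \<Longrightarrow> code x \<in> X \<and> R x (code x)"
    using assms(2) by metis
  show ?thesis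
  proof (intro exI[of _ "inv_into \<P> code ` code ` \<P>"] conjI ballI)
    show "finite (inv_into \<P> code ` code ` \<P>)"
      using code by (intro finite_imageI finite_subset[OF _ assms(1)]) auto
    show "inv_into \<P> code ` code ` \<P> \<subseteq> \<P>"
      by (auto simp: inv_into_into)
    show "\<exists>y\<in>inv_into \<P> code ` code ` \<P>. eqv x y" if "x \<in> \<P>" for x
    proof (rule bexI)
      show "inv_into \<P> code (code x) \<in> inv_into \<P> code ` code ` \<P>"
        using that by auto
      show "eqv x (inv_into \<P> code (code x))"
        using assms(3) code that by (metis f_inv_into_f image_eqI inv_into_into)
    qed
  qed
qed

theorem theorem1p2:
  "\<exists>F :: (real ^ 'd) set set.
     finite F \<and>
     (\<forall>Q\<in>F. hollow_lattice_d_polytope Q) \<and>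
     (\<forall>P. hollow_lattice_d_polytope P \<and> \<not> (\<exists>Q\<in>F. unimodularly_equivalent P Q)
        \<longrightarrow> projects_onto_hollow P)"
proof -
  obtain n where n: "\<And>\<Lambda> S :: (real ^ 'd) set. normalized \<Lambda> S \<Longrightarrow>
      \<forall>v. \<not> hollow_direction \<Lambda> (convex hull S) v \<Longrightarrow> perp (dual_box n \<Lambda>) = {0}"
    using perp_trivial_if_no_hollow_direction[where 'd = 'd] by blast
  \<comment> \<open>A finite set containing \<open>\<Lambda> \<inter> cbox (- 1) 1\<close> for every
    normalized pair without a hollow direction; \<open>D\<close> runs over the possible values of
    \<open>dual_box n \<Lambda>\<close>.\<close>
  define Y where "Y = (\<Union>D\<in>{D. D \<subseteq> int_box n \<and> perp D = {0}}. annih D \<inter> cbox (- 1) (1 :: real ^ 'd))"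
  have "finite Y"
    unfolding Y_def
  proof (rule finite_UN_I)
    show "finite {D. D \<subseteq> int_box n \<and> perp D = ({0} :: (real ^ 'd) set)}"
      by (rule finite_subset[of _ "Pow (int_box n)"]) (auto simp: finite_int_box)
  qed (auto intro: finite_annih_if_perp_trivial finite_subset[OF _ finite_int_box])
  define X where "X = Pow Y \<times> (hull) convex ` Pow Y"
  \<comment> \<open>A code records the normalized polytope and the trace of the lattice on the cube,
    which determines the lattice.\<close>
  define R where "R P c \<longleftrightarrow> (\<exists>A B b S. A ** B = mat 1 \<and> B ** A = mat 1 \<and> b \<in> int_lattice \<and>
      normalized ((*v) A ` int_lattice) S \<and> P = (\<lambda>x. B *v x + b) ` (convex hull S) \<and>
      c = ((*v) A ` int_lattice \<inter> cbox (- 1) 1, convex hull S))" for P :: "(real ^ 'd) set" and c :: "(real ^ 'd) set \<times> (real ^ 'd) set"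
  define \<P> where "\<P> = {P :: (real ^ 'd) set. hollow_lattice_d_polytope P \<and> \<not> projects_onto_hollow P}"
  have "finite X"
    using \<open>finite Y\<close> by (simp add: X_def)
  moreover have "\<exists>c\<in>X. R P c" if "P \<in> \<P>" for P
  proof -
    have P: "hollow_lattice_d_polytope P" "\<not> projects_onto_hollow P"
      using that by (auto simp: \<P>_def)
    from P(1) obtain A B :: "real ^ 'd ^ 'd" and b S where
      norm: "A ** B = mat 1" "B ** A = mat 1" "b \<in> int_lattice"
        "normalized ((*v) A ` int_lattice) S" "P = (\<lambda>x. B *v x + b) ` (convex hull S)"
      by (rule ex_normalized)
    define \<Lambda> where "\<Lambda> = (*v) A ` int_lattice"
    \<comment> \<open>A hollow direction of the normalized polytope would carry over to
      \<open>P\<close> and give a projection.\<close>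
    have "\<not> hollow_direction \<Lambda> (convex hull S) v" for v
      using hollow_direction_affine_image[OF norm(1-3), of "convex hull S" v] P norm(5)
        projects_onto_hollow_if_hollow_direction by (auto simp: \<Lambda>_def)
    then have "perp (dual_box n \<Lambda>) = {0}"
      using n norm(4) by (simp add: \<Lambda>_def)
    moreover have "\<Lambda> \<subseteq> annih (dual_box n \<Lambda>)" "dual_box n \<Lambda> \<subseteq> int_box n"
      by (auto simp: dual_box_def annih_def inner_commute)
    ultimately have "\<Lambda> \<inter> cbox (- 1) 1 \<subseteq> Y"
      unfolding Y_def by blast
    moreover from this have "S \<subseteq> Y"
      using norm(4) by (auto simp: normalized_def \<Lambda>_def)
    ultimately have "(\<Lambda> \<inter> cbox (- 1) 1, convex hull S) \<in> X"
      by (simp add: X_def)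
    moreover have "R P (\<Lambda> \<inter> cbox (- 1) 1, convex hull S)"
      unfolding R_def \<Lambda>_def using norm by blast
    ultimately show ?thesis
      by blast
  qed
  moreover have "unimodularly_equivalent P P'" if P: "R P c" "R P' c" for P P' c
  proof -
    obtain A B b S where norm: "A ** B = mat 1" "B ** A = mat 1" "b \<in> int_lattice"
        "normalized ((*v) A ` int_lattice) S" "P = (\<lambda>x. B *v x + b) ` (convex hull S)"
        "c = ((*v) A ` int_lattice \<inter> cbox (- 1) 1, convex hull S)"
      using P(1) unfolding R_def by blast
    obtain A' B' b' S' where norm': "A' ** B' = mat 1" "B' ** A' = mat 1" "b' \<in> int_lattice"
        "normalized ((*v) A' ` int_lattice) S'" "P' = (\<lambda>x. B' *v x + b') ` (convex hull S')"
        "c = ((*v) A' ` int_lattice \<inter> cbox (- 1) 1, convex hull S')"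
      using P(2) unfolding R_def by blast
    have "(*v) A ` int_lattice = (*v) A' ` int_lattice"
      by (rule superlattice_eqI) (use norm(4,6) norm'(4,6) in \<open>auto simp: normalized_def\<close>)
    moreover have "convex hull S = convex hull S'"
      using norm(6) norm'(6) by simp
    ultimately show ?thesis
      using unimodularly_equivalent_if_same_normalization[OF norm(1,2) norm'(1,2) norm(3) norm'(3)]
        norm(5) norm'(5) by simp
  qed
  ultimately have "\<exists>F\<subseteq>\<P>. finite F \<and> (\<forall>P\<in>\<P>. \<exists>Q\<in>F. unimodularly_equivalent P Q)"
    by (rule finite_representatives)
  then obtain F where "F \<subseteq> \<P>" "finite F" "\<forall>P\<in>\<P>. \<exists>Q\<in>F. unimodularly_equivalent P Q"
    by auto
  then show ?thesis
    by (intro exI[of _ F]) (auto simp: \<P>_def)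
qed

end
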